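(* For the single-machine scheduling problem with uniform linear deterioration and release times, any $\rho$-approximation algorithm for minimizing the sum of completion times $\sum_{i\in\mathcal{J}}C_i$ is $(1+\rho)$-approximate for minimizing the makespan.
   Context: Problem: a single machine must process a set $\mathcal{J}=\{1,\ldots,n\}$ of jobs non-preemptively, at most one job at a time. Job $i$ has a release time $r_i\ge 0$ and a fixed processing time $\alpha_i\ge 0$, and there is a common deterioration rate $\beta>0$. If job $i$ starts at time $s_i\ge r_i$, its processing time is $p_i(s_i)=\alpha_i+\beta s_i$, so it completes at $C_i=(1+\beta)s_i+\alpha_i$. A schedule is feasible if jobs do not overlap and $s_i\ge r_i$ for all $i$. The makespan is $\max_i C_i$ and the total completion time is $\sum_i C_i$. An algorithm is $\rho$-approximate for an objective if on every instance it returns a feasible schedule whose objective value is at most $\rho$ times the optimal objective value.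
   Formalization: The algorithm is additionally assumed to return schedules without unnecessary idle time: each job starts at its release time or at another job's completion. If arbitrary idle time may be inserted, the claim is false (2 jobs, r=0, α=1, β=1, starts 0 and 9, ρ=5). *)

theory Defs
  imports Complex_Main
begin

record sched_inst =
  njobs :: nat
  release :: "nat \<Rightarrow> real"
  fixed_time :: "nat \<Rightarrow> real"
  rate :: real

text \<open>A schedule is given by its start times; values outside the set of jobs are irrelevant.\<close>
type_synonym schedule = "nat \<Rightarrow> real"

type_synonym objective = "sched_inst \<Rightarrow> schedule \<Rightarrow> real"

type_synonym algorithm = "sched_inst \<Rightarrow> schedule"

definition jobs :: "sched_inst \<Rightarrow> nat set" where
  "jobs I = {1..njobs I}"

text \<open>At least one job is required, since the makespan of no jobs is a maximum over the empty set.\<close>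
definition valid_inst :: "sched_inst \<Rightarrow> bool" where
  "valid_inst I \<longleftrightarrow>
     1 \<le> njobs I \<and> 0 < rate I \<and> (\<forall>i\<in>jobs I. 0 \<le> release I i \<and> 0 \<le> fixed_time I i)"

definition proc_time :: "sched_inst \<Rightarrow> schedule \<Rightarrow> nat \<Rightarrow> real" where
  "proc_time I s i = fixed_time I i + rate I * s i"

definition completion :: "sched_inst \<Rightarrow> schedule \<Rightarrow> nat \<Rightarrow> real" where
  "completion I s i = s i + proc_time I s i"

definition feasible :: "sched_inst \<Rightarrow> schedule \<Rightarrow> bool" where
  "feasible I s \<longleftrightarrow>
     (\<forall>i\<in>jobs I. release I i \<le> s i) \<and>
     (\<forall>i\<in>jobs I. \<forall>j\<in>jobs I. i \<noteq> j \<longrightarrow> completion I s i \<le> s j \<or> completion I s j \<le> s i)"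

definition makespan :: objective where
  "makespan I s = Max (completion I s ` jobs I)"

definition total_completion :: objective where
  "total_completion I s = (\<Sum>i\<in>jobs I. completion I s i)"

text \<open>For a valid instance and either objective this infimum is over a nonempty set of
  nonnegative reals.\<close>
definition opt_value :: "objective \<Rightarrow> sched_inst \<Rightarrow> real" where
  "opt_value f I = (INF s\<in>{s. feasible I s}. f I s)"

definition approx_algorithm :: "real \<Rightarrow> objective \<Rightarrow> algorithm \<Rightarrow> bool" where
  "approx_algorithm \<rho> f A \<longleftrightarrow>
     (\<forall>I. valid_inst I \<longrightarrow> feasible I (A I) \<and> f I (A I) \<le> \<rho> * opt_value f I)"

text \<open>A feasible schedule is semi-active if no job can be started earlier without changing the
  processing order: each job starts at its release time or as soon as another job completes.
  An algorithm that outputs a job sequence, processed without unnecessary idle time, returns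
  such schedules. Inserted idle time can ruin the makespan at little cost in total completion
  time: for two jobs with release time 0, fixed time 1 and rate 1, the optimal values are 4
  (total completion time) and 3 (makespan), while start times 0 and 9 give completion times 1
  and 19, hence total 20 = 5 * 4 but makespan 19 > (1 + 5) * 3.\<close>
definition semi_active :: "sched_inst \<Rightarrow> schedule \<Rightarrow> bool" where
  "semi_active I s \<longleftrightarrow>
     (\<forall>i\<in>jobs I. s i = release I i \<or> (\<exists>j\<in>jobs I - {i}. s i = completion I s j))"

end

theory Submission
  imports Defs
begin

text \<open>Write \<open>P\<close> for the total processing time of a schedule and \<open>M\<close> for its makespan. Since
  \<open>C\<^sub>i = s\<^sub>i + p\<^sub>i\<close> and \<open>p\<^sub>i = \<alpha>\<^sub>i + \<beta> s\<^sub>i\<close>, we have \<open>(1 + \<beta>) P = \<beta> \<Sum>C\<^sub>i + \<Sum>\<alpha>\<^sub>i\<close>, so a factor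
  \<open>\<rho> \<ge> 1\<close> for \<open>\<Sum>C\<^sub>i\<close> carries over to \<open>P\<close>. Disjointness of the processing intervals gives \<open>P \<le> M\<close>
  for every feasible schedule. In a semi-active schedule the machine never idles after the
  last release time \<open>R\<close>, so \<open>M \<le> P + R\<close>, and \<open>R\<close> is at most the makespan of any feasible
  schedule.\<close>

lemma finite_jobs [simp]: "finite (jobs I)"
  by (simp add: jobs_def)

lemma jobs_nonempty: "valid_inst I \<Longrightarrow> jobs I \<noteq> {}"
  by (simp add: valid_inst_def jobs_def)

lemma completion_le_makespan: "i \<in> jobs I \<Longrightarrow> completion I s i \<le> makespan I s"
  by (simp add: makespan_def)

lemma start_nonneg:
  assumes "valid_inst I" "feasible I s" "i \<in> jobs I"
  shows "0 \<le> s i"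
  using assms by (fastforce simp: valid_inst_def feasible_def)

lemma proc_time_nonneg:
  assumes "valid_inst I" "feasible I s" "i \<in> jobs I"
  shows "0 \<le> proc_time I s i"
  using assms start_nonneg[OF assms] by (simp add: valid_inst_def proc_time_def)

lemma release_le_completion:
  assumes "valid_inst I" "feasible I s" "i \<in> jobs I"
  shows "release I i \<le> completion I s i"
  using assms proc_time_nonneg[OF assms] by (fastforce simp: completion_def feasible_def)

lemma release_le_makespan:
  assumes "valid_inst I" "feasible I s" "i \<in> jobs I"
  shows "release I i \<le> makespan I s"
  using release_le_completion[OF assms] completion_le_makespan[OF assms(3)] by (rule order_trans)

lemma completion_nonneg:
  assumes "valid_inst I" "feasible I s" "i \<in> jobs I"
  shows "0 \<le> completion I s i"
  using start_nonneg[OF assms] proc_time_nonneg[OF assms] by (simp add: completion_def)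

lemma sum_proc_time_eq:
  "(1 + rate I) * (\<Sum>i\<in>jobs I. proc_time I s i) =
     rate I * total_completion I s + (\<Sum>i\<in>jobs I. fixed_time I i)"
  by (simp add: total_completion_def completion_def proc_time_def sum.distrib algebra_simps
      sum_distrib_left)

text \<open>Induction on the number of intervals, removing one with the latest start
  \<open>s k\<close>. If it has positive length, all others must end by \<open>s k\<close>, so the
  rest fits into \<open>[0, s k]\<close>; hence the bound \<open>T\<close> is kept
  arbitrary.\<close>

lemma sum_disjoint_lengths_le:
  fixes s p :: "'a \<Rightarrow> real"
  assumes "finite J"
    and "\<And>i. i \<in> J \<Longrightarrow> 0 \<le> s i" "\<And>i. i \<in> J \<Longrightarrow> 0 \<le> p i" "\<And>i. i \<in> J \<Longrightarrow> s i + p i \<le> T"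
    and "\<And>i j. i \<in> J \<Longrightarrow> j \<in> J \<Longrightarrow> i \<noteq> j \<Longrightarrow> s i + p i \<le> s j \<or> s j + p j \<le> s i"
    and "0 \<le> T"
  shows "sum p J \<le> T"
  using assms
proof (induction "card J" arbitrary: J T)
  case 0
  then show ?case by simp
next
  case (Suc n)
  then have "J \<noteq> {}" by auto
  then obtain k where k: "k \<in> J" and s_max: "\<And>j. j \<in> J \<Longrightarrow> s j \<le> s k"
    using Max_in[of "s ` J"] Max_ge[of "s ` J"] Suc.prems(1) by fastforce
  have sum_eq: "sum p J = p k + sum p (J - {k})"
    using Suc.prems(1) k by (rule sum.remove)
  have n: "n = card (J - {k})"
    using Suc.hyps(2) k Suc.prems(1) by simp
  have rest_le: "sum p (J - {k}) \<le> T'"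
    if "\<And>j. j \<in> J - {k} \<Longrightarrow> s j + p j \<le> T'" "0 \<le> T'" for T'
    using Suc.hyps(1)[OF n, of T'] Suc.prems(1,2,3,5) that by simp
  show ?case
  \<comment> \<open>An interval of length 0 may share its start with a longer one that ends after
    \<open>s k\<close>. It adds nothing to the sum, so there the rest is bounded by \<open>T\<close>
    itself.\<close>
  proof (cases "p k = 0")
    case True
    then show ?thesis using rest_le[of T] Suc.prems(4,6) sum_eq by simp
  next
    case False
    then have "s j + p j \<le> s k" if "j \<in> J - {k}" for j
      using Suc.prems(3)[OF k] Suc.prems(5)[of j k] s_max[of j] k that by auto
    then have "sum p (J - {k}) \<le> s k"
      using rest_le[of "s k"] Suc.prems(2)[OF k] by blast
    then show ?thesis using sum_eq Suc.prems(4)[OF k] by simp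
  qed
qed

lemma sum_proc_time_le_makespan:
  assumes "valid_inst I" "feasible I s"
  shows "(\<Sum>i\<in>jobs I. proc_time I s i) \<le> makespan I s"
proof (rule sum_disjoint_lengths_le[where s = s])
  obtain i where "i \<in> jobs I" using jobs_nonempty[OF assms(1)] by blast
  then show "0 \<le> makespan I s"
    using completion_nonneg[OF assms] completion_le_makespan by (meson order_trans)
  show "s i + proc_time I s i \<le> makespan I s" if "i \<in> jobs I" for i
    using completion_le_makespan[OF that] by (simp add: completion_def)
  show "s i + proc_time I s i \<le> s j \<or> s j + proc_time I s j \<le> s i"
    if "i \<in> jobs I" "j \<in> jobs I" "i \<noteq> j" for i j
    using assms(2) that by (auto simp: feasible_def completion_def)
qed (use start_nonneg[OF assms] proc_time_nonneg[OF assms] in auto)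

text \<open>A job starting after \<open>R\<close> starts exactly when another job completes.
  Following such predecessors back without gaps leads to a start no later than \<open>R\<close>. The
  induction counts the jobs with strictly earlier start; restricting the sum to starts up to
  \<open>s i\<close> leaves room to add the job itself at each step.\<close>

lemma semi_active_completion_le:
  assumes valid: "valid_inst I" and feas: "feasible I s" and semi: "semi_active I s"
    and R: "\<And>i. i \<in> jobs I \<Longrightarrow> release I i \<le> R"
    and "i \<in> jobs I"
  shows "completion I s i \<le> R + (\<Sum>j | j \<in> jobs I \<and> s j \<le> s i. proc_time I s j)"
  using \<open>i \<in> jobs I\<close>
proof (induction "card {j \<in> jobs I. s j < s i}" arbitrary: i rule: less_induct)
  case less
  note p_nonneg = proc_time_nonneg[OF valid feas]
  have R_nonneg: "0 \<le> R"
    using R[OF less.prems] valid less.prems by (force simp: valid_inst_def)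
  have p_le: "proc_time I s i \<le> (\<Sum>j | j \<in> jobs I \<and> s j \<le> s i. proc_time I s j)"
    by (rule member_le_sum) (use less.prems p_nonneg in auto)
  have "s i = release I i \<or> (\<exists>j\<in>jobs I - {i}. s i = completion I s j)"
    using semi less.prems by (simp add: semi_active_def)
  \<comment> \<open>A start beyond \<open>R\<close> is positive because \<open>R\<close> is
    nonnegative. This excludes empty jobs at time 0 that are predecessors of each other.\<close>
  then consider "s i \<le> R" | j where "j \<in> jobs I" "s i = completion I s j" "0 < s i"
    using R[OF less.prems] R_nonneg by fastforce
  then show ?case
  proof cases
    case 1
    then show ?thesis using p_le by (simp add: completion_def)
  next
    case (2 j)
    \<comment> \<open>Processing times vanish only at time 0, so the predecessor starts strictly earlier.\<close>
    have "s j < s i"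
    proof (cases "s j = 0")
      case False
      then have "0 < rate I * s j" "0 \<le> fixed_time I j"
        using start_nonneg[OF valid feas 2(1)] valid 2(1) by (auto simp: valid_inst_def)
      then show ?thesis using 2(2) by (simp add: completion_def proc_time_def)
    qed (use 2 in simp)
    then have "{l \<in> jobs I. s l < s j} \<subset> {l \<in> jobs I. s l < s i}"
      using 2(1) by auto
    then have "completion I s j \<le> R + (\<Sum>l | l \<in> jobs I \<and> s l \<le> s j. proc_time I s l)"
      using less.hyps 2(1) by (simp add: psubset_card_mono)
    \<comment> \<open>Since \<open>s j < s i\<close>, job \<open>i\<close> is not yet counted in the
      bound for \<open>j\<close>.\<close>
    moreover have "(\<Sum>l | l \<in> jobs I \<and> s l \<le> s j. proc_time I s l) + proc_time I s i
        = (\<Sum>l \<in> insert i {l \<in> jobs I. s l \<le> s j}. proc_time I s l)"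
      using \<open>s j < s i\<close> by simp
    moreover have "\<dots> \<le> (\<Sum>l | l \<in> jobs I \<and> s l \<le> s i. proc_time I s l)"
      by (rule sum_mono2) (use \<open>s j < s i\<close> less.prems p_nonneg in auto)
    ultimately show ?thesis using 2(2) unfolding completion_def[of I s i] by linarith
  qed
qed

lemma semi_active_makespan_le:
  assumes "valid_inst I" "feasible I s" "semi_active I s"
    and "\<And>i. i \<in> jobs I \<Longrightarrow> release I i \<le> R"
  shows "makespan I s \<le> R + (\<Sum>i\<in>jobs I. proc_time I s i)"
proof -
  have "completion I s i \<le> R + (\<Sum>j\<in>jobs I. proc_time I s j)" if "i \<in> jobs I" for i
  proof -
    have "(\<Sum>j | j \<in> jobs I \<and> s j \<le> s i. proc_time I s j) \<le> (\<Sum>j\<in>jobs I. proc_time I s j)"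
      by (rule sum_mono2) (use proc_time_nonneg[OF assms(1,2)] in auto)
    then show ?thesis
      using semi_active_completion_le[OF assms that] by linarith
  qed
  then show ?thesis using jobs_nonempty[OF assms(1)] by (simp add: makespan_def)
qed

lemma total_opt_le:
  assumes "valid_inst I" "feasible I s"
  shows "opt_value total_completion I \<le> total_completion I s"
  unfolding opt_value_def
proof (rule cINF_lower)
  show "bdd_below (total_completion I ` {s. feasible I s})"
    by (rule bdd_belowI2[where m = 0])
      (use completion_nonneg[OF assms(1)] in \<open>auto simp: total_completion_def intro!: sum_nonneg\<close>)
qed (use assms in simp)

text \<open>The output of \<open>A\<close> costs at least the optimum, so one instance with positive
  optimum forces this.\<close>

lemma approx_factor_ge_1:
  assumes "approx_algorithm \<rho> total_completion A"
  shows "1 \<le> \<rho>"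
proof -
  \<comment> \<open>Release time 1 keeps the optimum at least 1; an optimum of 0 would say nothing
    about \<open>\<rho>\<close>.\<close>
  define I where "I = \<lparr>njobs = 1, release = \<lambda>_. 1, fixed_time = \<lambda>_. 0, rate = 1\<rparr>"
  have valid: "valid_inst I" and jobs: "jobs I = {1}"
    by (auto simp: I_def valid_inst_def jobs_def)
  from assms valid have feas: "feasible I (A I)"
    and le: "total_completion I (A I) \<le> \<rho> * opt_value total_completion I"
    by (auto simp: approx_algorithm_def)
  have "1 \<le> opt_value total_completion I"
    unfolding opt_value_def
  proof (rule cINF_greatest)
    show "1 \<le> total_completion I s" if "s \<in> {s. feasible I s}" for s
      using release_le_completion[OF valid, of s 1] that
      by (simp add: total_completion_def jobs) (simp add: I_def)
  qed (use feas in blast)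
  moreover have "opt_value total_completion I \<le> \<rho> * opt_value total_completion I"
    using total_opt_le[OF valid feas] le by linarith
  ultimately show ?thesis by simp
qed

theorem theorem16:
  fixes \<rho> :: real and A :: algorithm
  assumes "approx_algorithm \<rho> total_completion A"
    and "\<And>I. valid_inst I \<Longrightarrow> semi_active I (A I)"
  shows "approx_algorithm (1 + \<rho>) makespan A"
  unfolding approx_algorithm_def
proof (intro allI impI conjI)
  fix I assume valid: "valid_inst I"
  with assms(1) show feas: "feasible I (A I)" by (simp add: approx_algorithm_def)
  have \<rho>: "1 \<le> \<rho>" using assms(1) by (rule approx_factor_ge_1)
  \<comment> \<open>The optimum is an infimum, so the comparison is made with every feasible
    \<open>s\<close>.\<close>
  have bound: "makespan I (A I) \<le> (1 + \<rho>) * makespan I s" if s: "feasible I s" for s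
  proof -
    let ?P = "\<lambda>s. \<Sum>i\<in>jobs I. proc_time I s i"
    let ?F = "\<Sum>i\<in>jobs I. fixed_time I i"
    have rate: "0 < rate I" and F: "0 \<le> ?F"
      using valid by (auto simp: valid_inst_def intro: sum_nonneg)
    have "total_completion I (A I) \<le> \<rho> * opt_value total_completion I"
      using assms(1) valid by (simp add: approx_algorithm_def)
    also have "\<dots> \<le> \<rho> * total_completion I s"
      using total_opt_le[OF valid s] \<rho> by simp
    finally have "rate I * total_completion I (A I) \<le> rate I * (\<rho> * total_completion I s)"
      using rate by simp
    \<comment> \<open>The fixed times are the same in both schedules, so scaling their sum by
      \<open>\<rho>\<close> uses \<open>1 \<le> \<rho>\<close>.\<close>
    moreover have "?F \<le> \<rho> * ?F"
      using mult_right_mono[OF \<rho> F] by simp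
    ultimately have "(1 + rate I) * ?P (A I) \<le> \<rho> * ((1 + rate I) * ?P s)"
      unfolding sum_proc_time_eq by (simp add: algebra_simps)
    then have "?P (A I) \<le> \<rho> * ?P s"
      using rate by (simp add: mult.left_commute[of \<rho>])
    also have "\<dots> \<le> \<rho> * makespan I s"
      using sum_proc_time_le_makespan[OF valid s] \<rho> by simp
    finally show ?thesis
      \<comment> \<open>Here \<open>R\<close> is the makespan of the comparison schedule
        \<open>s\<close>, which contributes the summand 1 of \<open>1 + \<rho>\<close>.\<close>
      using semi_active_makespan_le[OF valid feas assms(2)[OF valid] release_le_makespan[OF valid s]]
      by (simp add: algebra_simps)
  qed
  \<comment> \<open>After division the left side is a lower bound independent of \<open>s\<close>,
    so it passes to the infimum.\<close>
  have "makespan I (A I) / (1 + \<rho>) \<le> opt_value makespan I"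
    unfolding opt_value_def
    by (rule cINF_greatest) (use feas bound \<rho> in \<open>auto simp: field_simps\<close>)
  then show "makespan I (A I) \<le> (1 + \<rho>) * opt_value makespan I"
    using \<rho> by (simp add: field_simps)
qed

end
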